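(* Every Polish Banach space is strongly $\mathcal{K}_{\sigma\delta}$.
   Context: Banach spaces are real. A Banach space $X$ is called Polish if its closed unit ball with the weak topology, $(B_X,w)$, is a Polish topological space (homeomorphic to a complete separable metric space). A subset $A$ of a topological space $T$ is strongly $\mathcal{K}_{\sigma\delta}$ if there are compact subsets $K_{n,m}$ ($n,m\in\mathbb{N}$) of $T$ with $A=\bigcap_{n=1}^\infty\bigcup_{m=1}^\infty K_{n,m}$ and such that for each compact $L\subseteq A$ and each $n$ there is $m$ with $L\subseteq K_{n,m}$. A Banach space $X$ is called strongly $\mathcal{K}_{\sigma\delta}$ if $X$ is a strongly $\mathcal{K}_{\sigma\delta}$ subset of $(X^{**},w^* )$ (with $X$ canonically embedded in $X^{**}$). *)

theory Defs
  imports "HOL-Analysis.Analysis"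
begin

definition polish_space :: "'t topology \<Rightarrow> bool" where
  "polish_space T \<longleftrightarrow> completely_metrizable_space T \<and> separable_space T"

text \<open>The weak topology on \<open>X\<close> is the initial topology for all bounded linear functionals;
  \<open>euclidean\<close> is here the product topology on functions from the dual to the reals.\<close>

definition weak_topology :: "'a::real_normed_vector topology" where
  "weak_topology = pullback_topology UNIV (\<lambda>x (f :: 'a \<Rightarrow>\<^sub>L real). blinfun_apply f x) euclidean"

text \<open>A Banach space is given as a type of class \<open>banach\<close>, and properties of it are predicates
  on the type. Its bidual is the type \<open>('a \<Rightarrow>\<^sub>L real) \<Rightarrow>\<^sub>L real\<close>.\<close>

definition polish_banach :: "'a::banach itself \<Rightarrow> bool" where
  "polish_banach _ \<longleftrightarrow> polish_space (subtopology weak_topology (cball (0 :: 'a) 1))"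

definition strongly_K_sigma_delta_in :: "'t topology \<Rightarrow> 't set \<Rightarrow> bool" where
  "strongly_K_sigma_delta_in T A \<longleftrightarrow>
     (\<exists>K :: nat \<Rightarrow> nat \<Rightarrow> 't set.
        (\<forall>n m. compactin T (K n m)) \<and>
        A = (\<Inter>n. \<Union>m. K n m) \<and>
        (\<forall>L n. compactin T L \<longrightarrow> L \<subseteq> A \<longrightarrow> (\<exists>m. L \<subseteq> K n m)))"

text \<open>On a dual space, that is for real-valued operators, the library's topology of pointwise
  convergence \<open>strong_operator_topology\<close> is the weak-star topology.\<close>

abbreviation weak_star_topology :: "('b::real_normed_vector \<Rightarrow>\<^sub>L real) topology" where
  "weak_star_topology \<equiv> strong_operator_topology"

lift_definition canonical_embedding ::
    "'a::real_normed_vector \<Rightarrow> (('a \<Rightarrow>\<^sub>L real) \<Rightarrow>\<^sub>L real)" is "\<lambda>x f. blinfun_apply f x"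
  by (rule blinfun.bounded_linear_left)

definition strongly_K_sigma_delta_banach :: "'a::banach itself \<Rightarrow> bool" where
  "strongly_K_sigma_delta_banach _ \<longleftrightarrow>
     strongly_K_sigma_delta_in weak_star_topology (range (canonical_embedding :: 'a \<Rightarrow> _))"

end

theory Submission
  imports Defs
begin

text \<open>Let \<open>d\<close> be a complete metric for the weak topology of the unit ball \<open>B\<close>. For natural numbers
  \<open>k > 0\<close> and \<open>a\<close>, every \<open>x\<close> in \<open>X\<close> has a basic weak-star neighbourhood in the bidual whose trace on
  \<open>k B\<close> has \<open>d\<close>-diameter (after rescaling) less than \<open>1/(a+1)\<close>; this trace is empty when \<open>x\<close> lies outside
  \<open>k B\<close>, which is weakly closed by Hahn-Banach. The weak topology of \<open>X\<close> is Lindelof, so countably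
  many of these neighbourhoods, halved and closed, still cover \<open>X\<close> by their interiors. Intersecting finite
  unions of them with balls of the bidual gives the compact sets \<open>K (k, a) m\<close>, and a weak-star compact
  subset of \<open>X\<close>, being bounded, lies in one of them. If \<open>z\<close> belongs to \<open>\<Union>m. K (k, a) m\<close> for all \<open>k\<close>
  and \<open>a\<close>, fix \<open>k \<ge> norm z\<close>; by Goldstine the points of \<open>k B\<close> in the neighbourhoods of \<open>z\<close> so
  obtained form a Cauchy sequence for \<open>d\<close>, whose weak limit is \<open>z\<close>.\<close>

subsection \<open>Hahn-Banach\<close>

text \<open>Positive homogeneity is stated as an inequality only; using it for \<open>c\<close> and
  for \<open>1/c\<close> gives equality.\<close>

definition sublinear :: "('a::real_vector \<Rightarrow> real) \<Rightarrow> bool" where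
  "sublinear p \<longleftrightarrow> (\<forall>x y. p (x + y) \<le> p x + p y) \<and> (\<forall>c>0. \<forall>x. p (c *\<^sub>R x) \<le> c * p x)"

lemma sublinear_add: "sublinear p \<Longrightarrow> p (x + y) \<le> p x + p y"
  by (simp add: sublinear_def)

lemma sublinear_zero:
  assumes "sublinear p" shows "p 0 = 0"
proof -
  have "p (c *\<^sub>R 0) \<le> c * p 0" if "c > 0" for c using assms that unfolding sublinear_def by blast
  \<comment> \<open>Factor 2 gives \<open>p 0 \<ge> 0\<close>, factor 1/2 gives
    \<open>p 0 \<le> 0\<close>.\<close>
  from this[of 2] this[of "1/2"] show ?thesis by simp
qed

lemma sublinear_scaleR:
  assumes "sublinear p" "c \<ge> 0" shows "p (c *\<^sub>R x) = c * p x"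
proof (cases "c = 0")
  case False
  with assms have c: "c > 0" by simp
  have 1: "p (c *\<^sub>R x) \<le> c * p x" using assms(1) c by (simp add: sublinear_def)
  have "p ((1/c) *\<^sub>R (c *\<^sub>R x)) \<le> (1/c) * p (c *\<^sub>R x)"
    using assms(1) c unfolding sublinear_def by (meson zero_less_divide_1_iff)
  then have "c * p x \<le> p (c *\<^sub>R x)" using c by (simp add: field_simps)
  with 1 show ?thesis by simp
qed (simp add: sublinear_zero assms)

lemma sublinear_minus:
  assumes "sublinear p" shows "- p (- x) \<le> p x"
  using sublinear_add[OF assms, of x "-x"] sublinear_zero[OF assms] by simp

text \<open>Auxiliary functional for Hahn-Banach: it lies below \<open>p\<close> (take
  \<open>t = 0\<close>) and its value at \<open>-y\<close> is at most \<open>- p y\<close> (take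
  \<open>t = 1\<close>), so it pushes \<open>p\<close> towards linearity along
  \<open>y\<close>.\<close>

definition sublinear_reduct :: "('a::real_vector \<Rightarrow> real) \<Rightarrow> 'a \<Rightarrow> 'a \<Rightarrow> real" where
  "sublinear_reduct p y x = (INF t\<in>{0..}. p (x + t *\<^sub>R y) - t * p y)"

lemma sublinear_reduct_le:
  assumes "sublinear p" "t \<ge> 0"
  shows "sublinear_reduct p y x \<le> p (x + t *\<^sub>R y) - t * p y"
  unfolding sublinear_reduct_def
proof (rule cINF_lower)
  show "bdd_below ((\<lambda>t. p (x + t *\<^sub>R y) - t * p y) ` {0..})"
  proof (rule bdd_belowI2)
    fix s :: real assume "s \<in> {0..}"
    then show "- p (-x) \<le> p (x + s *\<^sub>R y) - s * p y"
      using sublinear_add[OF assms(1), of "x + s *\<^sub>R y" "-x"] sublinear_scaleR[OF assms(1), of s y]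
      by simp
  qed
qed (use assms in auto)

lemma sublinear_reduct_greatest:
  assumes "\<And>t. t \<ge> 0 \<Longrightarrow> b \<le> p (x + t *\<^sub>R y) - t * p y"
  shows "b \<le> sublinear_reduct p y x"
  unfolding sublinear_reduct_def by (rule cINF_greatest) (use assms in auto)

text \<open>The parameter \<open>t + s\<close> is admissible for \<open>u + v\<close>, so the infima
  over \<open>t\<close> and over \<open>s\<close> can be taken one after the other. Homogeneity
  comes from replacing \<open>t\<close> by \<open>c * t\<close>.\<close>

lemma sublinear_sublinear_reduct:
  assumes p: "sublinear p" shows "sublinear (sublinear_reduct p y)"
  unfolding sublinear_def
proof (intro conjI allI impI)
  fix u v
  have *: "sublinear_reduct p y (u + v) \<le> (p (u + t *\<^sub>R y) - t * p y) + (p (v + s *\<^sub>R y) - s * p y)"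
    if "t \<ge> 0" "s \<ge> 0" for t s
    using sublinear_reduct_le[OF p, of "t + s" y "u + v"] that
      sublinear_add[OF p, of "u + t *\<^sub>R y" "v + s *\<^sub>R y"]
    by (simp add: algebra_simps)
  have "sublinear_reduct p y (u + v) - (p (u + t *\<^sub>R y) - t * p y) \<le> sublinear_reduct p y v"
    if "t \<ge> 0" for t
    by (rule sublinear_reduct_greatest) (use *[OF that] in \<open>simp add: diff_le_eq add.commute\<close>)
  then have "sublinear_reduct p y (u + v) - sublinear_reduct p y v \<le> sublinear_reduct p y u"
    by (intro sublinear_reduct_greatest) (simp add: algebra_simps)
  then show "sublinear_reduct p y (u + v) \<le> sublinear_reduct p y u + sublinear_reduct p y v"
    by simp
next
  fix c :: real and x assume c: "c > 0"
  have "sublinear_reduct p y (c *\<^sub>R x) / c \<le> sublinear_reduct p y x"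
  proof (rule sublinear_reduct_greatest)
    fix t :: real assume t: "t \<ge> 0"
    show "sublinear_reduct p y (c *\<^sub>R x) / c \<le> p (x + t *\<^sub>R y) - t * p y"
      using sublinear_reduct_le[OF p, of "c * t" y "c *\<^sub>R x"] c t
        sublinear_scaleR[OF p, of c "x + t *\<^sub>R y"]
      by (simp add: field_simps)
  qed
  then show "sublinear_reduct p y (c *\<^sub>R x) \<le> c * sublinear_reduct p y x"
    using c by (simp add: field_simps)
qed

lemma sublinear_reduct_le_self:
  assumes "sublinear p" shows "sublinear_reduct p y x \<le> p x"
  using sublinear_reduct_le[OF assms, of 0] by simp

text \<open>Zorn's lemma for the reversed order. A chain is bounded below by its pointwise infimum,
  which is finite because \<open>- p (-x) \<le> q x\<close>, and subadditive because of any two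
  members of a chain one lies below both.\<close>

lemma sublinear_minimal:
  assumes p: "sublinear p"
  obtains q where "sublinear q" "q \<le> p" "\<And>r. sublinear r \<Longrightarrow> r \<le> q \<Longrightarrow> r = q"
proof -
  let ?A = "{q. sublinear q \<and> q \<le> p}"
  have "\<exists>m\<in>?A. \<forall>a\<in>?A. a \<le> m \<longrightarrow> a = m"
  proof (rule predicate_Zorn)
    show "partial_order_on ?A (relation_of (\<lambda>x y. y \<le> x) ?A)"
      by (rule partial_order_on_relation_ofI) auto
  next
    fix C assume C: "C \<in> Chains (relation_of (\<lambda>x y. y \<le> x) ?A)"
    then have CA: "C \<subseteq> ?A" and tot: "\<And>a b. a \<in> C \<Longrightarrow> b \<in> C \<Longrightarrow> a \<le> b \<or> b \<le> a"
      unfolding Chains_def relation_of_def by auto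
    show "\<exists>u\<in>?A. \<forall>a\<in>C. u \<le> a"
    proof (cases "C = {}")
      case True with p show ?thesis by auto
    next
      case False
      define u where "u x = (INF q\<in>C. q x)" for x
      have bdd: "bdd_below ((\<lambda>q. q x) ` C)" for x
      proof (rule bdd_belowI2)
        fix q assume "q \<in> C"
        then have "sublinear q" "q (-x) \<le> p (-x)" using CA by (auto simp: le_fun_def)
        then show "- p (-x) \<le> q x" using sublinear_minus[of q x] by linarith
      qed
      have le: "u x \<le> q x" if "q \<in> C" for q x
        unfolding u_def by (rule cINF_lower[OF bdd that])
      have gr: "b \<le> u x" if "\<And>q. q \<in> C \<Longrightarrow> b \<le> q x" for b x
        unfolding u_def by (rule cINF_greatest[OF False that])
      have "sublinear u"
        unfolding sublinear_def
      proof (intro conjI allI impI)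
        fix x y
        have *: "u (x + y) \<le> q x + r y" if q: "q \<in> C" and r: "r \<in> C" for q r
        proof -
          obtain s where s: "s \<in> C" "s \<le> q" "s \<le> r" using tot[OF q r] q r by auto
          have "u (x + y) \<le> s (x + y)" by (rule le[OF s(1)])
          also have "\<dots> \<le> s x + s y" using s CA by (intro sublinear_add) auto
          also have "\<dots> \<le> q x + r y" using s by (intro add_mono) (auto simp: le_fun_def)
          finally show ?thesis .
        qed
        have "u (x + y) - q x \<le> u y" if "q \<in> C" for q
          by (rule gr) (use *[OF that] in \<open>simp add: algebra_simps\<close>)
        then have "u (x + y) - u y \<le> u x"
          by (intro gr) (simp add: algebra_simps)
        then show "u (x + y) \<le> u x + u y" by simp
      next
        fix c :: real and x assume c: "c > 0"
        have "u (c *\<^sub>R x) / c \<le> u x"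
        proof (rule gr)
          fix q assume q: "q \<in> C"
          then have "q (c *\<^sub>R x) = c * q x" using CA c by (intro sublinear_scaleR) auto
          then show "u (c *\<^sub>R x) / c \<le> q x"
            using le[OF q, of "c *\<^sub>R x"] c by (simp add: field_simps)
        qed
        then show "u (c *\<^sub>R x) \<le> c * u x" using c by (simp add: field_simps)
      qed
      moreover have le': "u \<le> q" if "q \<in> C" for q
        using le[OF that] by (simp add: le_fun_def)
      moreover have "u \<le> p"
      proof -
        obtain q where "q \<in> C" using False by blast
        with CA have "q \<le> p" by blast
        with le'[OF \<open>q \<in> C\<close>] show ?thesis by (rule order_trans)
      qed
      ultimately show ?thesis by blast
    qed
  qed
  then obtain q where "sublinear q" "q \<le> p" "\<And>r. sublinear r \<Longrightarrow> r \<le> p \<Longrightarrow> r \<le> q \<Longrightarrow> r = q"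
    by blast
  then show ?thesis by (intro that) (blast intro: order_trans)+
qed

text \<open>A minimal sublinear functional coincides with all its reducts, which forces additivity.\<close>

lemma sublinear_dominates_linear:
  assumes p: "sublinear p"
  obtains f where "linear f" "f \<le> p"
proof -
  obtain q where q: "sublinear q" "q \<le> p" and min: "\<And>r. sublinear r \<Longrightarrow> r \<le> q \<Longrightarrow> r = q"
    using sublinear_minimal[OF p] by blast
  have red: "sublinear_reduct q y = q" for y
    by (rule min) (auto simp: sublinear_sublinear_reduct q le_fun_def sublinear_reduct_le_self)
  \<comment> \<open>With \<open>t = 1\<close> the reduct inequality becomes
    \<open>q x \<le> q (x + y) - q y\<close>, the reverse of subadditivity.\<close>
  have add: "q (x + y) = q x + q y" for x y
    using sublinear_reduct_le[OF q(1), of 1 y x] sublinear_add[OF q(1), of x y] by (simp add: red)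
  have neg: "q (- x) = - q x" for x
    using add[of x "-x"] sublinear_zero[OF q(1)] by simp
  have "linear q"
  proof (rule linearI)
    fix c x
    show "q (c *\<^sub>R x) = c *\<^sub>R q x"
    proof (cases "c \<ge> 0")
      case False
      then show ?thesis using sublinear_scaleR[OF q(1), of "-c" x] neg[of "(-c) *\<^sub>R x"] by simp
    qed (simp add: sublinear_scaleR q)
  qed (rule add)
  with q that show ?thesis by blast
qed

text \<open>A linear functional below the reduct of the norm along \<open>x\<close> is below the
  norm, and at \<open>-x\<close> it is at most \<open>- norm x\<close>; together these force the
  value \<open>norm x\<close> at \<open>x\<close>.\<close>

theorem norming_functional:
  fixes x :: "'a::real_normed_vector"
  obtains f :: "'a \<Rightarrow>\<^sub>L real" where "norm f \<le> 1" "blinfun_apply f x = norm x"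
proof -
  have n: "sublinear (norm :: 'a \<Rightarrow> real)"
    by (auto simp: sublinear_def norm_triangle_ineq)
  obtain f where f: "linear f" "f \<le> sublinear_reduct norm x"
    using sublinear_dominates_linear[OF sublinear_sublinear_reduct[OF n]] by blast
  have le: "f v \<le> norm v" for v
    using f(2) sublinear_reduct_le_self[OF n, of x v] by (meson le_fun_def order_trans)
  have "\<bar>f v\<bar> \<le> norm v" for v
    using le[of v] le[of "-v"] linear_neg[OF f(1), of v] by simp
  then have bl: "bounded_linear f"
    by (intro bounded_linear.intro f bounded_linear_axioms.intro exI[of _ 1]) simp
  have "f (-x) \<le> - norm x"
    using f(2) sublinear_reduct_le[OF n, of 1 x "-x"] by (force simp: le_fun_def intro: order_trans)
  then have fx: "f x = norm x" using le[of x] linear_neg[OF f(1), of x] by simp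
  show ?thesis
  proof
    show "norm (Blinfun f) \<le> 1"
      by (rule norm_blinfun_bound) (use \<open>\<And>v. \<bar>f v\<bar> \<le> norm v\<close> in \<open>auto simp: bounded_linear_Blinfun_apply bl\<close>)
    show "blinfun_apply (Blinfun f) x = norm x"
      by (simp add: bounded_linear_Blinfun_apply bl fx)
  qed
qed

subsection \<open>Uniform boundedness, Banach-Alaoglu and Goldstine\<close>

text \<open>Baire category: the closed sets \<open>E n\<close> on which all of \<open>S\<close> is
  bounded by \<open>n\<close> cover the space, so one of them contains a ball, and a bound on a ball
  bounds the operator norms.\<close>

theorem uniform_boundedness:
  fixes S :: "('b::banach \<Rightarrow>\<^sub>L 'c::real_normed_vector) set"
  assumes "\<And>x. \<exists>B. \<forall>z\<in>S. norm (blinfun_apply z x) \<le> B"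
  shows "\<exists>B. \<forall>z\<in>S. norm z \<le> B"
proof -
  define E where "E n = {x. \<forall>z\<in>S. norm (blinfun_apply z x) \<le> real n}" for n
  have clo: "closed (E n)" for n
  proof -
    have "E n = (\<Inter>z\<in>S. {x. norm (blinfun_apply z x) \<le> real n})" by (auto simp: E_def)
    moreover have "closed {x. norm (blinfun_apply z x) \<le> real n}" for z :: "'b \<Rightarrow>\<^sub>L 'c"
      by (intro closed_Collect_le continuous_intros)
    ultimately show ?thesis by auto
  qed
  have UN: "(\<Union>n. E n) = UNIV"
  proof -
    have "\<exists>n. x \<in> E n" for x
    proof -
      obtain B where "\<forall>z\<in>S. norm (blinfun_apply z x) \<le> B" using assms by blast
      moreover obtain n :: nat where "B \<le> real n" using real_arch_simple by blast
      ultimately have "x \<in> E n" unfolding E_def by (blast intro: order_trans)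
      then show ?thesis ..
    qed
    then show ?thesis by auto
  qed
  have "\<exists>n. interior (E n) \<noteq> {}"
  proof (rule ccontr)
    assume "\<not> ?thesis"
    then have "euclidean interior_of \<Union>(range E) = {}"
      by (intro Baire_category_alt) (auto simp: completely_metrizable_space_euclidean clo)
    then show False by (simp add: UN)
  qed
  then obtain n x where "x \<in> interior (E n)" by blast
  then obtain r where r: "r > 0" "cball x r \<subseteq> E n" by (meson mem_interior_cball)
  have "norm z \<le> 2 * real n / r" if z: "z \<in> S" for z
  proof (rule norm_blinfun_bound)
    fix v
    show "norm (blinfun_apply z v) \<le> 2 * real n / r * norm v"
    proof (cases "v = 0")
      case False
      \<comment> \<open>Rescaling \<open>v\<close> to norm \<open>r\<close> puts
        \<open>x + w\<close> into the ball, and \<open>z w\<close> is the difference of two values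
        of norm at most \<open>n\<close>.\<close>
      define w where "w = (r / norm v) *\<^sub>R v"
      have "norm w = r" using False r by (simp add: w_def)
      then have "x + w \<in> E n" "x \<in> E n" using r by (auto simp: subset_iff dist_norm)
      then have "norm (blinfun_apply z (x + w)) \<le> n" "norm (blinfun_apply z x) \<le> n"
        using z by (auto simp: E_def)
      then have "norm (blinfun_apply z w) \<le> 2 * real n"
        using norm_triangle_ineq4[of "blinfun_apply z (x + w)" "blinfun_apply z x"]
        by (simp add: blinfun.add_right)
      then show ?thesis using False r by (simp add: w_def blinfun.scaleR_right field_simps)
    qed simp
  qed (use r in simp)
  then show ?thesis by blast
qed

text \<open>Banach-Alaoglu: by Tychonoff the product \<open>P\<close> of intervals is compact,
  linearity is a closed condition on it, and \<open>Blinfun\<close> is continuous from pointwise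
  convergence to the weak-star topology.\<close>

lemma compactin_weak_star_cball:
  "compactin weak_star_topology (cball (0 :: 'b::real_normed_vector \<Rightarrow>\<^sub>L real) m)"
proof -
  define P where "P = (PiE UNIV (\<lambda>f::'b. cball (0::real) (m * norm f)))"
  define C where "C = P \<inter> {g. linear g}"
  have "compactin (product_topology (\<lambda>_. euclidean) UNIV) P"
    unfolding P_def compactin_PiE by simp
  then have "compact P" by (simp add: euclidean_product_topology)
  moreover have "closed {g :: 'b \<Rightarrow> real. linear g}"
  proof -
    have eq: "{g :: 'b \<Rightarrow> real. linear g} =
        (\<Inter>x y. {g. g (x + y) = g x + g y}) \<inter> (\<Inter>c x. {g. g (c *\<^sub>R x) = c *\<^sub>R g x})"
      by (auto simp: linear_iff)
    have add: "closed {g :: 'b \<Rightarrow> real. g (x + y) = g x + g y}" for x y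
      by (intro closed_Collect_eq continuous_intros continuous_on_product_coordinates)
    have scale: "closed {g :: 'b \<Rightarrow> real. g (c *\<^sub>R x) = c *\<^sub>R g x}" for c x
      by (intro closed_Collect_eq continuous_intros continuous_on_product_coordinates)
    show ?thesis unfolding eq by (intro closed_Int closed_INT ballI add scale)
  qed
  ultimately have "compact C" unfolding C_def by (rule compact_Int_closed)
  have bl: "bounded_linear g" if "g \<in> C" for g
  proof -
    have "\<bar>g x\<bar> \<le> norm x * m" for x
      using that by (auto simp: C_def P_def PiE_def mult.commute)
    then show ?thesis
      using that by (intro bounded_linear.intro bounded_linear_axioms.intro) (auto simp: C_def)
  qed
  have "continuous_map (top_of_set C) weak_star_topology Blinfun"
    unfolding continuous_on_strong_operator_topo_iff_coordinatewise
  proof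
    fix x :: 'b
    have "continuous_on C (\<lambda>g. g x)"
      by (rule continuous_on_subset[OF continuous_on_product_coordinates]) simp
    then have "continuous_on C (\<lambda>g. blinfun_apply (Blinfun g) x)"
      by (rule continuous_on_eq) (simp add: bounded_linear_Blinfun_apply bl)
    then show "continuous_map (top_of_set C) euclidean (\<lambda>g. blinfun_apply (Blinfun g) x)"
      by simp
  qed
  then have "compactin weak_star_topology (Blinfun ` C)"
    by (rule image_compactin[rotated]) (simp add: compactin_subtopology \<open>compact C\<close>)
  moreover have "Blinfun ` C = cball 0 m" if "m \<ge> 0"
  proof (intro equalityI subsetI)
    fix z assume "z \<in> Blinfun ` C"
    then obtain g where g: "g \<in> C" "z = Blinfun g" by blast
    then have "norm z \<le> m"
      by (intro norm_blinfun_bound) (use that in \<open>auto simp: C_def P_def PiE_def bounded_linear_Blinfun_apply bl\<close>)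
    then show "z \<in> cball 0 m" by simp
  next
    fix z :: "'b \<Rightarrow>\<^sub>L real" assume "z \<in> cball 0 m"
    then have "norm z \<le> m" by simp
    then have "\<bar>blinfun_apply z x\<bar> \<le> m * norm x" for x
      using norm_blinfun[of z x] by (metis mult_right_mono norm_ge_zero order_trans real_norm_def)
    then have "blinfun_apply z \<in> C"
      by (auto simp: C_def P_def blinfun.bounded_linear_right bounded_linear.linear)
    then show "z \<in> Blinfun ` C" by (metis blinfun_apply_inverse image_eqI)
  qed
  \<comment> \<open>For negative \<open>m\<close> the ball is empty.\<close>
  ultimately show ?thesis
    by (cases "m \<ge> 0") (simp_all add: not_le)
qed

text \<open>If \<open>x\<close> almost minimises the distance \<open>Q\<close>, comparison with the segments from \<open>x\<close> to the points
  of the ball shows that the functional \<open>g\<close> with coefficients \<open>z f - f x\<close> almost attains its norm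
  at \<open>x\<close>, whence \<open>Q x = z g - g x\<close> is small.\<close>

theorem goldstine:
  fixes z :: "('a::real_normed_vector \<Rightarrow>\<^sub>L real) \<Rightarrow>\<^sub>L real"
  assumes F: "finite F" and z: "norm z \<le> k" and k: "k > 0" and e: "e > 0"
  obtains x where "norm x \<le> k" "\<And>f. f \<in> F \<Longrightarrow> \<bar>blinfun_apply f x - blinfun_apply z f\<bar> < e"
proof -
  define Q where "Q x = (\<Sum>f\<in>F. (z f - blinfun_apply f x)\<^sup>2)" for x
  define \<delta> where "\<delta> = (INF x\<in>cball 0 k. Q x)"
  have bdd: "bdd_below (Q ` cball 0 k)"
    by (rule bdd_belowI2[of _ 0]) (simp add: Q_def sum_nonneg)
  have \<delta>_le: "\<delta> \<le> Q x" if "norm x \<le> k" for x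
    unfolding \<delta>_def by (rule cINF_lower[OF bdd]) (use that in simp)
  have "\<not> \<delta> > 0"
  proof
    assume \<delta>: "\<delta> > 0"
    \<comment> \<open>Two points of the ball differ by at most \<open>2 * k\<close> in norm, so
      \<open>M\<close> dominates the quadratic coefficient of \<open>Q\<close> along every segment
      from \<open>x\<close> inside the ball; the summand 1 makes it positive.\<close>
    define M where "M = (\<Sum>f\<in>F. (norm f * (2 * k))\<^sup>2) + 1"
    have M: "M > 0" unfolding M_def by (smt (verit) sum_nonneg zero_le_power2)
    \<comment> \<open>\<open>t \<le> 1\<close> keeps \<open>x + t *\<^sub>R (y - x)\<close> in the
      ball, and \<open>t * M < \<delta>\<close> yields the final contradiction.\<close>
    define t where "t = min 1 (\<delta> / (2 * M))"
    have t: "0 < t" "t \<le> 1" "t * M < \<delta>"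
    proof -
      show "0 < t" "t \<le> 1" using \<delta> M by (auto simp: t_def)
      have "t * M \<le> \<delta> / (2 * M) * M" unfolding t_def using M by (intro mult_right_mono) auto
      also have "\<dots> < \<delta>" using \<delta> M by simp
      finally show "t * M < \<delta>" .
    qed
    \<comment> \<open>The slack matches the bound for the quadratic term, so that division by
      \<open>2 * t\<close> leaves the error \<open>t * M\<close>.\<close>
    have "\<exists>y\<in>Q ` cball 0 k. y < \<delta> + t\<^sup>2 * M"
      unfolding \<delta>_def by (rule cInf_lessD) (use k t M in \<open>auto\<close>)
    then obtain x where x: "norm x \<le> k" "Q x < \<delta> + t\<^sup>2 * M" by auto
    \<comment> \<open>Up to the factor -2 this is the derivative of \<open>Q\<close> at
      \<open>x\<close>.\<close>
    define g where "g = (\<Sum>f\<in>F. (z f - blinfun_apply f x) *\<^sub>R f)"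
    have g: "blinfun_apply g y = (\<Sum>f\<in>F. (z f - blinfun_apply f x) * blinfun_apply f y)" for y
      by (simp add: g_def blinfun.sum_left blinfun.scaleR_left)
    have gy: "g y \<le> g x + t * M" if y: "norm y \<le> k" for y
    proof -
      have yx: "norm (y - x) \<le> 2 * k" using norm_triangle_ineq4[of y x] x y by simp
      have "norm (x + t *\<^sub>R (y - x)) = norm ((1 - t) *\<^sub>R x + t *\<^sub>R y)"
        by (simp add: algebra_simps)
      also have "\<dots> \<le> (1 - t) * k + t * k"
        using t x y by (intro norm_triangle_le add_mono) (auto intro!: mult_left_mono)
      finally have "\<delta> \<le> Q (x + t *\<^sub>R (y - x))" by (intro \<delta>_le) (simp add: algebra_simps)
      also have "\<dots> = (\<Sum>f\<in>F. (z f - f x)\<^sup>2 - 2 * t * ((z f - f x) * f (y - x)) + t\<^sup>2 * (f (y - x))\<^sup>2)"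
        unfolding Q_def
      proof (intro sum.cong refl)
        fix f
        have fe: "blinfun_apply f (x + t *\<^sub>R (y - x)) = f x + t * f (y - x)"
          by (simp add: blinfun.add_right blinfun.scaleR_right)
        show "(z f - blinfun_apply f (x + t *\<^sub>R (y - x)))\<^sup>2
            = (z f - f x)\<^sup>2 - 2 * t * ((z f - f x) * f (y - x)) + t\<^sup>2 * (f (y - x))\<^sup>2"
          unfolding fe by (simp add: power2_eq_square algebra_simps)
      qed
      also have "\<dots> = Q x - 2 * t * g (y - x) + t\<^sup>2 * (\<Sum>f\<in>F. (blinfun_apply f (y - x))\<^sup>2)"
        by (simp add: Q_def g sum.distrib sum_subtractf sum_distrib_left)
      also have "(\<Sum>f\<in>F. (blinfun_apply f (y - x))\<^sup>2) \<le> M"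
      proof -
        have "(blinfun_apply f (y - x))\<^sup>2 \<le> (norm f * (2 * k))\<^sup>2" for f :: "'a \<Rightarrow>\<^sub>L real"
          using norm_blinfun[of f "y - x"] yx k
          by (intro abs_le_square_iff[THEN iffD1])
            (smt (verit) mult_left_mono norm_ge_zero real_norm_def)
        then show ?thesis unfolding M_def by (smt (verit) sum_mono)
      qed
      finally have "\<delta> \<le> Q x - 2 * t * g (y - x) + t\<^sup>2 * M" by (simp add: mult_left_mono)
      then have "t * (2 * g (y - x)) \<le> t * (2 * (t * M))"
        using x(2) by (simp add: power2_eq_square algebra_simps)
      then have "g (y - x) \<le> t * M" using t by simp
      then show ?thesis by (simp add: blinfun.diff_right)
    qed
    have "norm g \<le> (g x + t * M) / k"
    proof (rule norm_blinfun_bound)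
      show nn: "0 \<le> (g x + t * M) / k" using gy[of 0] k by simp
      fix v
      show "norm (g v) \<le> (g x + t * M) / k * norm v"
      proof (cases "v = 0")
        case False
        define w where "w = (k / norm v) *\<^sub>R v"
        have w: "norm w \<le> k" using False k by (simp add: w_def)
        have "g w \<le> g x + t * M" "- g w \<le> g x + t * M"
          using gy[OF w] gy[of "-w"] w by (simp_all add: blinfun.minus_right)
        then have "\<bar>g w\<bar> \<le> g x + t * M" by simp
        then show ?thesis using False k
          by (simp add: w_def blinfun.scaleR_right abs_mult field_simps)
      qed simp
    qed
    then have "norm g * k \<le> g x + t * M" using k by (simp add: field_simps)
    moreover have "z g \<le> norm g * k"
      using norm_blinfun[of z g] z
      by (smt (verit) mult.commute mult_right_mono norm_ge_zero real_norm_def)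
    \<comment> \<open>This closes the chain \<open>\<delta> \<le> Q x = z g - g x \<le> k * norm g -
      g x \<le> t * M < \<delta>\<close>.\<close>
    moreover have "z g - g x = Q x"
    proof -
      have zg: "z g = (\<Sum>f\<in>F. (z f - blinfun_apply f x) * z f)"
        by (simp add: g_def blinfun.sum_right blinfun.scaleR_right)
      show ?thesis
        unfolding zg g Q_def sum_subtractf[symmetric]
        by (intro sum.cong) (simp_all add: power2_eq_square algebra_simps)
    qed
    ultimately show False using \<delta>_le[OF x(1)] t by linarith
  qed
  then have "\<delta> < e\<^sup>2" using e by (smt (verit) zero_less_power)
  then have "\<exists>y\<in>Q ` cball 0 k. y < e\<^sup>2"
    unfolding \<delta>_def by (intro cInf_lessD) (use k in auto)
  then obtain x where x: "norm x \<le> k" "Q x < e\<^sup>2" by auto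
  show ?thesis
  proof
    fix f assume "f \<in> F"
    then have "(z f - blinfun_apply f x)\<^sup>2 \<le> Q x"
      unfolding Q_def using F by (intro member_le_sum) auto
    then have "\<bar>z f - blinfun_apply f x\<bar> < e"
      using x e by (intro power2_less_imp_less[of "\<bar>_\<bar>"]) auto
    then show "\<bar>blinfun_apply f x - z f\<bar> < e" by simp
  qed (rule x)
qed

section \<open>Lindelof property of separable metrizable spaces\<close>

lemma separable_metrizable_imp_Lindelof_space:
  assumes "metrizable_space X" "separable_space X"
  shows "Lindelof_space X"
proof -
  obtain M d where ms: "Metric_space M d" and X: "X = Metric_space.mtopology M d"
    using assms(1) unfolding metrizable_space_def by blast
  interpret Metric_space M d by (rule ms)
  obtain C where C: "countable C" "C \<subseteq> M" "mtopology closure_of C = M"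
    using assms(2) unfolding separable_space_def X by auto
  have "second_countable X"
    unfolding second_countable_def
  proof (intro exI conjI ballI allI impI)
    \<comment> \<open>A countable base: balls of radius 1/(n+1) about the points of a countable
      dense set. If this radius is below \<open>r / 2\<close>, such a ball containing
      \<open>x\<close> lies in \<open>mball x r\<close>.\<close>
    let ?B = "(\<lambda>(c, n). mball c (inverse (real (Suc n)))) ` (C \<times> (UNIV :: nat set))"
    show "countable ?B" using C by simp
    show "openin X V" if "V \<in> ?B" for V using that by (auto simp: X)
    fix U x assume "openin X U \<and> x \<in> U"
    then obtain r where r: "r > 0" "mball x r \<subseteq> U" and x: "x \<in> M"
      unfolding X openin_mtopology by blast
    obtain n where n: "inverse (real (Suc n)) < r / 2"
      using reals_Archimedean[of "r / 2"] r by auto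
    have "x \<in> mtopology closure_of C" using C x by simp
    then obtain c where c: "c \<in> C" "c \<in> mball x (inverse (real (Suc n)))"
      unfolding metric_closure_of by (smt (verit) inverse_positive_iff_positive mem_Collect_eq
          of_nat_0_less_iff zero_less_Suc)
    show "\<exists>V\<in>?B. x \<in> V \<and> V \<subseteq> U"
    proof (intro bexI conjI)
      show "x \<in> mball c (inverse (real (Suc n)))" using c by (auto simp: commute)
      have "mball c (inverse (real (Suc n))) \<subseteq> mball x r"
      proof
        fix y assume "y \<in> mball c (inverse (real (Suc n)))"
        then show "y \<in> mball x r" using c n triangle[of x c y] by auto
      qed
      then show "mball c (inverse (real (Suc n))) \<subseteq> U" using r by blast
    qed (use c in auto)
  qed
  then show ?thesis by (rule second_countable_imp_Lindelof_space)
qed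

subsection \<open>Weak and weak-star topologies\<close>

lemma topspace_weak_topology [simp]: "topspace weak_topology = UNIV"
  by (simp add: weak_topology_def topspace_pullback_topology)

lemma continuous_map_weak_topology:
  fixes f :: "'a::real_normed_vector \<Rightarrow>\<^sub>L real"
  shows "continuous_map weak_topology euclidean (blinfun_apply f)"
proof -
  have "continuous_map weak_topology euclidean ((\<lambda>g. g f) \<circ> (\<lambda>(x::'a) (f :: 'a \<Rightarrow>\<^sub>L real). blinfun_apply f x))"
    unfolding weak_topology_def
    by (rule continuous_map_pullback) (simp add: continuous_on_product_coordinates)
  then show ?thesis by (simp add: comp_def)
qed

lemma continuous_map_into_weak_topology:
  fixes g :: "'t \<Rightarrow> 'a::real_normed_vector"
  assumes "\<And>f :: 'a \<Rightarrow>\<^sub>L real. continuous_map T euclidean (\<lambda>t. blinfun_apply f (g t))"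
  shows "continuous_map T weak_topology g"
  unfolding weak_topology_def
proof (rule continuous_map_pullback')
  have "continuous_map T (product_topology (\<lambda>_. euclidean) UNIV)
      (\<lambda>t (f :: 'a \<Rightarrow>\<^sub>L real). blinfun_apply f (g t))"
    unfolding continuous_map_componentwise_UNIV using assms by simp
  then show "continuous_map T euclidean ((\<lambda>x (f :: 'a \<Rightarrow>\<^sub>L real). blinfun_apply f x) \<circ> g)"
    by (simp add: euclidean_product_topology comp_def)
qed simp

lemma continuous_map_weak_scaleR:
  "continuous_map weak_topology weak_topology ((*\<^sub>R) c :: 'a::real_normed_vector \<Rightarrow> 'a)"
proof (rule continuous_map_into_weak_topology)
  fix f :: "'a \<Rightarrow>\<^sub>L real"
  have "blinfun_apply f \<circ> (*\<^sub>R) c = blinfun_apply (c *\<^sub>R f)"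
    by (auto simp: blinfun.scaleR_right blinfun.scaleR_left)
  then show "continuous_map weak_topology euclidean (\<lambda>t. blinfun_apply f (c *\<^sub>R t))"
    using continuous_map_weak_topology[of "c *\<^sub>R f"] by (simp add: fun_eq_iff comp_def)
qed

lemma continuous_map_canonical_embedding:
  "continuous_map weak_topology weak_star_topology canonical_embedding"
  unfolding continuous_on_strong_operator_topo_iff_coordinatewise canonical_embedding.rep_eq
  by (simp add: continuous_map_weak_topology)

text \<open>The unit ball is Lindelof, being separable and metrizable; its dilates are continuous
  images of it, and countably many of them exhaust the space.\<close>

lemma Lindelof_space_weak_topology:
  assumes "polish_banach TYPE('a::banach)"
  shows "Lindelof_space (weak_topology :: 'a topology)"
proof -
  have B: "Lindelof_space (subtopology weak_topology (cball (0::'a) 1))"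
    using assms unfolding polish_banach_def polish_space_def
    by (intro separable_metrizable_imp_Lindelof_space)
      (auto intro: completely_metrizable_imp_metrizable_space)
  have "Lindelof_space (subtopology weak_topology (cball (0::'a) (real (Suc n))))" for n
  proof (rule Lindelof_space_continuous_map_image[OF B])
    have im: "(*\<^sub>R) (real (Suc n)) ` cball (0::'a) 1 = cball 0 (real (Suc n))"
      using cball_scale[of "real (Suc n)" "0::'a" 1] by simp
    then show "(*\<^sub>R) (real (Suc n)) ` topspace (subtopology weak_topology (cball (0::'a) 1))
        = topspace (subtopology weak_topology (cball (0::'a) (real (Suc n))))"
      by simp
    show "continuous_map (subtopology weak_topology (cball 0 1))
        (subtopology weak_topology (cball (0::'a) (real (Suc n)))) ((*\<^sub>R) (real (Suc n)))"
      unfolding continuous_map_in_subtopology using im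
      by (auto intro: continuous_map_from_subtopology continuous_map_weak_scaleR)
  qed
  then have "Lindelof_space (subtopology weak_topology (\<Union>(range (\<lambda>n. cball (0::'a) (real (Suc n))))))"
    by (intro Lindelof_space_Union) auto
  moreover have "(\<Union>n. cball (0::'a) (real (Suc n))) = UNIV"
  proof -
    have "\<exists>n. norm x \<le> real (Suc n)" for x :: 'a
      by (meson le_SucI of_nat_mono order_trans real_arch_simple le_refl)
    then show ?thesis by auto
  qed
  ultimately show ?thesis by simp
qed

section \<open>Basic weak-star neighbourhoods\<close>

definition weak_star_box :: "('b::real_normed_vector \<Rightarrow>\<^sub>L real) \<Rightarrow> 'b set \<Rightarrow> real \<Rightarrow> ('b \<Rightarrow>\<^sub>L real) set" where
  "weak_star_box z F e = {w. \<forall>f\<in>F. \<bar>blinfun_apply w f - blinfun_apply z f\<bar> < e}"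

text \<open>The non-strict variant is weak-star closed, hence has compact intersection with balls of
  a dual space.\<close>

definition weak_star_cbox :: "('b::real_normed_vector \<Rightarrow>\<^sub>L real) \<Rightarrow> 'b set \<Rightarrow> real \<Rightarrow> ('b \<Rightarrow>\<^sub>L real) set" where
  "weak_star_cbox z F e = {w. \<forall>f\<in>F. \<bar>blinfun_apply w f - blinfun_apply z f\<bar> \<le> e}"

lemma openin_weak_star_box:
  assumes "finite F" shows "openin weak_star_topology (weak_star_box z F e)"
proof -
  have "weak_star_box z F e = {w. \<forall>f\<in>F. blinfun_apply w f \<in> ball (blinfun_apply z f) e}"
    by (auto simp: weak_star_box_def dist_real_def abs_minus_commute)
  then show ?thesis using strong_operator_topology_basis[OF assms, of "\<lambda>f. ball (z f) e" "\<lambda>f. f"] by simp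
qed

lemma closedin_weak_star_cbox: "closedin weak_star_topology (weak_star_cbox z F e)"
proof -
  have 1: "closedin weak_star_topology {w. \<bar>blinfun_apply w f - blinfun_apply z f\<bar> \<le> e}" for f
    using closedin_continuous_map_preimage[OF strong_operator_topology_continuous_evaluation[of f],
        of "cball (z f) e"]
    by (simp add: strong_operator_topology_topspace dist_real_def abs_minus_commute)
  have "weak_star_cbox z F e = topspace weak_star_topology \<inter> (\<Inter>f\<in>F. {w. \<bar>blinfun_apply w f - blinfun_apply z f\<bar> \<le> e})"
    by (auto simp: weak_star_cbox_def strong_operator_topology_topspace)
  also have "closedin weak_star_topology \<dots>"
    by (cases "F = {}") (auto intro!: closedin_Int closedin_INT 1)
  finally show ?thesis .
qed

lemma open_fun_contains_box:
  fixes S :: "('i \<Rightarrow> real) set"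
  assumes "open S" "g \<in> S"
  obtains F e where "finite F" "e > 0" "\<And>h. (\<And>i. i \<in> F \<Longrightarrow> \<bar>h i - g i\<bar> < e) \<Longrightarrow> h \<in> S"
proof -
  have "openin (product_topology (\<lambda>_::'i. euclidean :: real topology) UNIV) S"
    using assms(1) by (simp add: euclidean_product_topology)
  then obtain U where fin: "finite {i. U i \<noteq> (UNIV :: real set)}" and op: "\<And>i. open (U i)"
    and g: "g \<in> PiE UNIV U" and sub: "PiE UNIV U \<subseteq> S"
    unfolding openin_product_topology_alt using assms(2) by auto
  let ?F = "{i. U i \<noteq> UNIV}"
  have "\<exists>e>0. ball (g i) e \<subseteq> U i" for i
    using op g by (meson PiE_E UNIV_I open_contains_ball)
  then obtain e where e: "\<And>i. e i > 0" "\<And>i. ball (g i) (e i) \<subseteq> U i" by metis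
  \<comment> \<open>The inserted 1 keeps the minimum defined and positive when no coordinate is
    restricted.\<close>
  define e0 where "e0 = Min (insert 1 (e ` ?F))"
  show ?thesis
  proof
    show "finite ?F" by (rule fin)
    show "e0 > 0" using fin e by (auto simp: e0_def)
    fix h assume h: "\<And>i. i \<in> ?F \<Longrightarrow> \<bar>h i - g i\<bar> < e0"
    have "h i \<in> U i" for i
    proof (cases "U i = UNIV")
      case False
      then have "e0 \<le> e i" using fin by (auto simp: e0_def)
      then have "h i \<in> ball (g i) (e i)" using h[of i] False by (auto simp: dist_real_def)
      with e show ?thesis by blast
    qed simp
    then show "h \<in> S" using sub by auto
  qed
qed

lemma openin_weak_star_contains_box:
  assumes "openin weak_star_topology U" "z \<in> U"
  obtains F e where "finite F" "e > 0" "weak_star_box z F e \<subseteq> U"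
proof -
  obtain S where S: "open S" "U = blinfun_apply -` S"
    using assms(1) unfolding strong_operator_topology_def openin_pullback_topology by auto
  obtain F e where "finite F" "e > 0" "\<And>h. (\<And>i. i \<in> F \<Longrightarrow> \<bar>h i - z i\<bar> < e) \<Longrightarrow> h \<in> S"
    using open_fun_contains_box[of S z] S assms(2) by auto
  then show ?thesis by (intro that[of F e]) (auto simp: weak_star_box_def S(2))
qed

text \<open>Weak neighbourhoods in \<open>X\<close> contain traces of weak-star boxes of the bidual,
  which is how weakly open sets are carried over to the bidual.\<close>

lemma openin_weak_contains_box:
  assumes "openin weak_topology U" "x \<in> U"
  obtains F e where "finite F" "e > 0"
    "\<And>y. canonical_embedding y \<in> weak_star_box (canonical_embedding x) F e \<Longrightarrow> y \<in> U"
proof -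
  obtain S where S: "open S" "U = (\<lambda>x (f :: 'a \<Rightarrow>\<^sub>L real). blinfun_apply f x) -` S"
    using assms(1) unfolding weak_topology_def openin_pullback_topology by auto
  obtain F e where Fe: "finite F" "e > 0"
      "\<And>h. (\<And>f. f \<in> F \<Longrightarrow> \<bar>h f - blinfun_apply f x\<bar> < e) \<Longrightarrow> h \<in> S"
    using open_fun_contains_box[of S "\<lambda>f. blinfun_apply f x"] S assms(2) by auto
  show ?thesis
  proof (rule that[OF Fe(1,2)])
    fix y assume "canonical_embedding y \<in> weak_star_box (canonical_embedding x) F e"
    then have "(\<lambda>f. blinfun_apply f y) \<in> S"
      by (intro Fe(3)) (auto simp: weak_star_box_def canonical_embedding.rep_eq)
    then show "y \<in> U" by (simp add: S(2))
  qed
qed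

lemma weak_star_dense_cball:
  fixes z :: "('a::real_normed_vector \<Rightarrow>\<^sub>L real) \<Rightarrow>\<^sub>L real"
  assumes "openin weak_star_topology U" "z \<in> U" "norm z \<le> k" "k > 0"
  obtains x where "norm x \<le> k" "canonical_embedding x \<in> U"
proof -
  obtain F e where Fe: "finite F" "e > 0" "weak_star_box z F e \<subseteq> U"
    using openin_weak_star_contains_box assms(1,2) by blast
  obtain x where x: "norm x \<le> k" "\<And>f. f \<in> F \<Longrightarrow> \<bar>blinfun_apply f x - z f\<bar> < e"
    using goldstine[OF Fe(1) assms(3,4) Fe(2)] by blast
  then have "canonical_embedding x \<in> weak_star_box z F e"
    by (auto simp: weak_star_box_def canonical_embedding.rep_eq)
  with x Fe show ?thesis by (intro that) auto
qed

text \<open>Evaluations are continuous, so they are bounded on a compact set; uniform boundedness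
  turns this into a norm bound.\<close>

lemma weak_star_compactin_bounded:
  fixes L :: "('b::banach \<Rightarrow>\<^sub>L real) set"
  assumes "compactin weak_star_topology L"
  obtains B where "\<And>z. z \<in> L \<Longrightarrow> norm z \<le> B"
proof -
  have "\<exists>B. \<forall>z\<in>L. norm (blinfun_apply z x) \<le> B" for x
  proof -
    have "compactin euclidean ((\<lambda>z. blinfun_apply z x) ` L)"
      by (rule image_compactin[OF assms strong_operator_topology_continuous_evaluation])
    then have "bounded ((\<lambda>z. blinfun_apply z x) ` L)" by (simp add: compact_imp_bounded)
    then show ?thesis by (auto simp: bounded_iff)
  qed
  then show ?thesis using uniform_boundedness[of L] that by blast
qed

subsection \<open>Neighbourhoods with small trace on a ball\<close>

text \<open>The metric \<open>d\<close> will live on the unit ball, so points of the ball of radius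
  \<open>k\<close> are rescaled before they are compared. A box with empty trace on that ball
  qualifies vacuously.\<close>

definition small_weak_star_box ::
    "('a \<Rightarrow> 'a \<Rightarrow> real) \<Rightarrow> real \<Rightarrow> real \<Rightarrow> 'a::real_normed_vector \<Rightarrow> ('a \<Rightarrow>\<^sub>L real) set \<Rightarrow> real \<Rightarrow> bool" where
  "small_weak_star_box d k \<eta> x F e \<longleftrightarrow>
     (\<forall>y y'. norm y \<le> k \<longrightarrow> norm y' \<le> k \<longrightarrow>
        canonical_embedding y \<in> weak_star_box (canonical_embedding x) F e \<longrightarrow>
        canonical_embedding y' \<in> weak_star_box (canonical_embedding x) F e \<longrightarrow>
        d (y /\<^sub>R k) (y' /\<^sub>R k) < \<eta>)"

lemma small_weak_star_box_exists:
  fixes x :: "'a::real_normed_vector"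
  assumes ms: "Metric_space M d"
    and top: "subtopology weak_topology (cball (0::'a) 1) = Metric_space.mtopology M d"
    and k: "k > 0" and \<eta>: "\<eta> > 0"
  obtains F e where "finite F" "e > 0" "small_weak_star_box d k \<eta> x F e"
proof (cases "norm x \<le> k")
  case False
  obtain f :: "'a \<Rightarrow>\<^sub>L real" where f: "norm f \<le> 1" "blinfun_apply f x = norm x"
    using norming_functional by blast
  \<comment> \<open>On the ball of radius \<open>k\<close> the functional \<open>f\<close> is at
    most \<open>k\<close>, while \<open>f x = norm x\<close>; the gap \<open>norm x - k\<close>
    serves as the radius of a box that misses the ball.\<close>
  have "canonical_embedding y \<notin> weak_star_box (canonical_embedding x) {f} (norm x - k)"
    if "norm y \<le> k" for y
  proof -
    have "\<bar>f y\<bar> \<le> norm f * norm y" using norm_blinfun[of f y] by simp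
    also have "\<dots> \<le> 1 * k" using f that by (intro mult_mono) auto
    finally show ?thesis by (auto simp: weak_star_box_def canonical_embedding.rep_eq f)
  qed
  then show ?thesis using False
    by (intro that[of "{f}" "norm x - k"]) (auto simp: small_weak_star_box_def)
next
  case True
  interpret Metric_space M d by (rule ms)
  have M: "M = cball 0 1" using arg_cong[OF top, of topspace] by simp
  \<comment> \<open>Radius \<open>\<eta> / 2\<close>, since two points of the trace are compared
    through \<open>x /\<^sub>R k\<close>.\<close>
  have "openin (subtopology weak_topology (cball (0::'a) 1)) (mball (x /\<^sub>R k) (\<eta> / 2))"
    by (simp add: top)
  then obtain U where U: "openin weak_topology U" "mball (x /\<^sub>R k) (\<eta> / 2) = U \<inter> cball 0 1"
    unfolding openin_subtopology by blast
  have in_M: "y /\<^sub>R k \<in> M" if "norm y \<le> k" for y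
    using that k by (simp add: M field_simps)
  have "openin weak_topology {y \<in> topspace weak_topology. (1 / k) *\<^sub>R y \<in> U}"
    by (rule openin_continuous_map_preimage[OF continuous_map_weak_scaleR U(1)])
  then have op: "openin weak_topology {y. y /\<^sub>R k \<in> U}" by (simp add: divide_inverse)
  have "x /\<^sub>R k \<in> mball (x /\<^sub>R k) (\<eta> / 2)" using in_M[OF True] \<eta> by simp
  then have xU: "x \<in> {y. y /\<^sub>R k \<in> U}" using U(2) by auto
  obtain F e where Fe: "finite F" "e > 0"
    "\<And>y. canonical_embedding y \<in> weak_star_box (canonical_embedding x) F e \<Longrightarrow> y /\<^sub>R k \<in> U"
    using openin_weak_contains_box[OF op xU] by (metis mem_Collect_eq)
  have near: "d (x /\<^sub>R k) (y /\<^sub>R k) < \<eta> / 2"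
    if "norm y \<le> k" "canonical_embedding y \<in> weak_star_box (canonical_embedding x) F e" for y
  proof -
    have "y /\<^sub>R k \<in> U \<inter> cball 0 1" using Fe(3)[OF that(2)] in_M[OF that(1)] M by simp
    then show ?thesis using U(2) by auto
  qed
  have "small_weak_star_box d k \<eta> x F e"
    unfolding small_weak_star_box_def
  proof (intro allI impI)
    fix y y' assume y: "norm y \<le> k" "norm y' \<le> k"
      "canonical_embedding y \<in> weak_star_box (canonical_embedding x) F e"
      "canonical_embedding y' \<in> weak_star_box (canonical_embedding x) F e"
    show "d (y /\<^sub>R k) (y' /\<^sub>R k) < \<eta>"
      using triangle'[of "y /\<^sub>R k" "x /\<^sub>R k" "y' /\<^sub>R k"] near[OF y(1,3)] near[OF y(2,4)]
        in_M[OF True] in_M[OF y(1)] in_M[OF y(2)] triangle[of "y /\<^sub>R k" "x /\<^sub>R k" "y' /\<^sub>R k"]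
        commute[of "y /\<^sub>R k" "x /\<^sub>R k"] by linarith
  qed
  with Fe show ?thesis by (intro that) auto
qed

lemma in_range_canonical_embedding:
  fixes z :: "('a::real_normed_vector \<Rightarrow>\<^sub>L real) \<Rightarrow>\<^sub>L real"
  assumes ms: "Metric_space M d" and complete: "Metric_space.mcomplete M d"
    and top: "subtopology weak_topology (cball (0::'a) 1) = Metric_space.mtopology M d"
    and k: "k > 0" and z: "norm z \<le> k"
    and box: "\<And>n. \<exists>x F e. finite F \<and> z \<in> weak_star_box (canonical_embedding x) F e \<and>
                small_weak_star_box d k (inverse (real (Suc n))) x F e"
  shows "z \<in> range canonical_embedding"
proof -
  interpret Metric_space M d by (rule ms)
  have M: "M = cball 0 1" using arg_cong[OF top, of topspace] by simp
  have in_M: "y /\<^sub>R k \<in> M" if "norm y \<le> k" for y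
    using that k by (simp add: M field_simps)
  obtain x F e where fin: "\<And>n. finite (F n)"
    and zin: "\<And>n. z \<in> weak_star_box (canonical_embedding (x n)) (F n) (e n)"
    and small: "\<And>n. small_weak_star_box d k (inverse (real (Suc n))) (x n) (F n) (e n)"
    using box by metis
  \<comment> \<open>The boxes need not be nested; finite intersections make them decrease, so points
    chosen from late \<open>W m\<close> lie in a common small box.\<close>
  define W where "W N = (\<Inter>n\<le>N. weak_star_box (canonical_embedding (x n)) (F n) (e n))" for N
  have W: "openin weak_star_topology (W N)" "z \<in> W N" for N
    unfolding W_def using fin zin by (auto intro!: openin_INT openin_weak_star_box)
  have W_small: "d (y /\<^sub>R k) (y' /\<^sub>R k) < inverse (real (Suc N))"
    if "norm y \<le> k" "norm y' \<le> k" "canonical_embedding y \<in> W m" "canonical_embedding y' \<in> W m'"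
      "N \<le> m" "N \<le> m'" for y y' N m m'
    using small[of N] that unfolding small_weak_star_box_def W_def by blast
  have "\<exists>y. norm y \<le> k \<and> canonical_embedding y \<in> W N" for N
    using weak_star_dense_cball[OF W z k] by blast
  then obtain y where y: "\<And>N. norm (y N) \<le> k" "\<And>N. canonical_embedding (y N) \<in> W N"
    by metis
  have "MCauchy (\<lambda>N. y N /\<^sub>R k)"
    unfolding MCauchy_def
  proof (intro conjI allI impI)
    show "range (\<lambda>N. y N /\<^sub>R k) \<subseteq> M" using in_M y by auto
    fix \<epsilon> :: real assume "\<epsilon> > 0"
    then obtain N where "inverse (real (Suc N)) < \<epsilon>" using reals_Archimedean by blast
    then show "\<exists>N. \<forall>n n'. N \<le> n \<longrightarrow> N \<le> n' \<longrightarrow> d (y n /\<^sub>R k) (y n' /\<^sub>R k) < \<epsilon>"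
      using W_small y by (meson less_trans)
  qed
  then obtain l where l: "limitin mtopology (\<lambda>N. y N /\<^sub>R k) l sequentially"
    using complete unfolding mcomplete_def by blast
  have "z f = f (k *\<^sub>R l)" for f
  proof -
    \<comment> \<open>The sequence \<open>y\<close> need not satisfy
      \<open>f (y N) \<longlonglongrightarrow> z f\<close> a priori. For each \<open>f\<close> a
      second sequence \<open>u\<close> is therefore chosen in the same sets \<open>W N\<close>, with
      \<open>f (u N)\<close> also close to \<open>z f\<close>; it has the same limit
      \<open>l\<close> because \<open>d\<close> between the rescaled \<open>u N\<close> and
      \<open>y N\<close> tends to 0.\<close>
    have "\<exists>u. norm u \<le> k \<and> canonical_embedding u \<in> W N \<inter> weak_star_box z {f} (inverse (real (Suc N)))" for N
    proof -
      have "openin weak_star_topology (W N \<inter> weak_star_box z {f} (inverse (real (Suc N))))"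
        by (intro openin_Int W openin_weak_star_box) simp
      moreover have "z \<in> W N \<inter> weak_star_box z {f} (inverse (real (Suc N)))"
        using W(2) by (simp add: weak_star_box_def)
      ultimately show ?thesis using weak_star_dense_cball[OF _ _ z k] by metis
    qed
    then obtain u where u: "\<And>N. norm (u N) \<le> k" "\<And>N. canonical_embedding (u N) \<in> W N"
      "\<And>N. canonical_embedding (u N) \<in> weak_star_box z {f} (inverse (real (Suc N)))"
      by (metis IntD1 IntD2)
    have "limitin mtopology (\<lambda>N. u N /\<^sub>R k) l sequentially"
    proof (rule limitin_metric[THEN iffD2], intro conjI allI impI)
      show lM: "l \<in> M" using l by (simp add: limitin_metric)
      fix \<epsilon> :: real assume \<epsilon>: "\<epsilon> > 0"
      have "\<forall>\<^sub>F N in sequentially. y N /\<^sub>R k \<in> M \<and> d (y N /\<^sub>R k) l < \<epsilon> / 2"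
        using l half_gt_zero[OF \<epsilon>] unfolding limitin_metric by blast
      moreover have "\<forall>\<^sub>F N in sequentially. inverse (real (Suc N)) < \<epsilon> / 2"
        using LIMSEQ_inverse_real_of_nat \<epsilon> by (intro order_tendstoD(2)) auto
      ultimately show "\<forall>\<^sub>F N in sequentially. u N /\<^sub>R k \<in> M \<and> d (u N /\<^sub>R k) l < \<epsilon>"
      proof eventually_elim
        case (elim N)
        have "d (u N /\<^sub>R k) (y N /\<^sub>R k) < inverse (real (Suc N))"
          using W_small[of "u N" "y N" N N N] u y by simp
        then show ?case
          using elim triangle[of "u N /\<^sub>R k" "y N /\<^sub>R k" l] in_M u(1) y(1) lM by force
      qed
    qed
    then have "limitin (subtopology weak_topology (cball 0 1)) (\<lambda>N. u N /\<^sub>R k) l sequentially"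
      by (simp add: top)
    then have "limitin euclidean (blinfun_apply f \<circ> (\<lambda>N. u N /\<^sub>R k)) (f l) sequentially"
      by (rule continuous_map_limit[OF continuous_map_from_subtopology[OF continuous_map_weak_topology]])
    then have "(\<lambda>N. f (u N /\<^sub>R k)) \<longlonglongrightarrow> f l" by (simp add: comp_def)
    then have "(\<lambda>N. k * f (u N /\<^sub>R k)) \<longlonglongrightarrow> k * f l" by (rule tendsto_mult_left)
    moreover have "k * f (u N /\<^sub>R k) = f (u N)" for N
      using k by (simp add: blinfun.scaleR_right)
    ultimately have "(\<lambda>N. f (u N)) \<longlonglongrightarrow> k * f l" by simp
    moreover have "(\<lambda>N. f (u N)) \<longlonglongrightarrow> blinfun_apply z f"
    proof (rule LIM_zero_cancel, rule Lim_null_comparison)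
      show "\<forall>\<^sub>F N in sequentially. norm (f (u N) - z f) \<le> inverse (real (Suc N))"
        using u(3)
        by (intro always_eventually allI less_imp_le)
          (simp add: weak_star_box_def canonical_embedding.rep_eq)
    qed (rule LIMSEQ_inverse_real_of_nat)
    ultimately have "k * f l = z f" by (rule LIMSEQ_unique)
    then show ?thesis by (simp add: blinfun.scaleR_right)
  qed
  then have "z = canonical_embedding (k *\<^sub>R l)"
    by (intro blinfun_eqI) (simp add: canonical_embedding.rep_eq)
  then show ?thesis by blast
qed

text \<open>The covering argument for one radius \<open>k\<close> and one precision
  \<open>\<eta>\<close>: Lindelof provides a countable cover of \<open>X\<close>, and compactness of
  \<open>L\<close> leaves finitely many boxes of it.\<close>

lemma weak_star_compact_cover:
  fixes d :: "'a::banach \<Rightarrow> 'a \<Rightarrow> real"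
  assumes P: "polish_banach TYPE('a)"
    and ms: "Metric_space M d"
    and top: "subtopology weak_topology (cball (0::'a) 1) = Metric_space.mtopology M d"
    and k: "k > 0" and \<eta>: "\<eta> > 0"
  obtains K :: "nat \<Rightarrow> (('a \<Rightarrow>\<^sub>L real) \<Rightarrow>\<^sub>L real) set"
  where "\<And>m. compactin weak_star_topology (K m)"
    and "\<And>L. compactin weak_star_topology L \<Longrightarrow> L \<subseteq> range canonical_embedding \<Longrightarrow> \<exists>m. L \<subseteq> K m"
    and "\<And>m z. z \<in> K m \<Longrightarrow> \<exists>x F e. finite F \<and> z \<in> weak_star_box (canonical_embedding x) F e \<and>
            small_weak_star_box d k \<eta> x F e"
proof -
  have "\<exists>F e. finite F \<and> e > 0 \<and> small_weak_star_box d k \<eta> x F e" for x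
    using small_weak_star_box_exists[OF ms top k \<eta>] by blast
  then obtain F e where fin: "\<And>x. finite (F x)" and e: "\<And>x. e x > 0"
    and small: "\<And>x. small_weak_star_box d k \<eta> x (F x) (e x)"
    by metis
  \<comment> \<open>With half the radius, the closed box around \<open>U x\<close> still lies in the
    open box of radius \<open>e x\<close>, which is small.\<close>
  define U where "U x = weak_star_box (canonical_embedding x) (F x) (e x / 2)" for x
  have U: "openin weak_star_topology (U x)" "canonical_embedding x \<in> U x" for x
    using fin e by (auto simp: U_def openin_weak_star_box) (auto simp: weak_star_box_def)
  have op: "openin weak_topology {y. canonical_embedding y \<in> U x}" for x
    using openin_continuous_map_preimage[OF continuous_map_canonical_embedding U(1)] by simp
  then have "\<exists>\<V>. countable \<V> \<and> \<V> \<subseteq> range (\<lambda>x. {y. canonical_embedding y \<in> U x}) \<and>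
      topspace (weak_topology :: 'a topology) \<subseteq> \<Union>\<V>"
    using Lindelof_space_weak_topology[OF P] unfolding Lindelof_space_alt
    by (elim allE impE) (use U(2) in auto)
  then obtain \<V> where \<V>: "countable \<V>" "\<V> \<subseteq> range (\<lambda>x. {y. canonical_embedding y \<in> U x})"
      "UNIV \<subseteq> \<Union>\<V>"
    by auto
  obtain C where C: "countable C" "\<V> = (\<lambda>x. {y. canonical_embedding y \<in> U x}) ` C"
    using countable_subset_image[of \<V> "\<lambda>x. {y. canonical_embedding y \<in> U x}" UNIV] \<V>(1,2) by blast
  have cov: "\<exists>x\<in>C. canonical_embedding y \<in> U x" for y
    using \<V>(3) C(2) by blast
  have "C \<noteq> {}" using cov by blast
  define s where "s = from_nat_into C"
  have s: "\<exists>i. canonical_embedding y \<in> U (s i)" for y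
    using cov[of y] from_nat_into_surj[OF C(1)] by (metis s_def)
  \<comment> \<open>One index bounds both the norm and the number of boxes, so the sets increase
    with \<open>m\<close> and a maximum of two indices suffices below.\<close>
  define K where "K m = cball 0 (real m) \<inter>
      (\<Union>i\<le>m. weak_star_cbox (canonical_embedding (s i)) (F (s i)) (e (s i) / 2))" for m
  show ?thesis
  proof
    show "compactin weak_star_topology (K m)" for m
      unfolding K_def
      by (intro compact_Int_closedin compactin_weak_star_cball closedin_Union)
        (auto intro: closedin_weak_star_cbox)
  next
    fix L :: "(('a \<Rightarrow>\<^sub>L real) \<Rightarrow>\<^sub>L real) set"
    assume L: "compactin weak_star_topology L" "L \<subseteq> range canonical_embedding"
    obtain B where B: "\<And>z. z \<in> L \<Longrightarrow> norm z \<le> B"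
      using weak_star_compactin_bounded[OF L(1)] by blast
    have "\<forall>V\<in>range (\<lambda>i. U (s i)). openin weak_star_topology V" "L \<subseteq> \<Union>(range (\<lambda>i. U (s i)))"
      using U s L(2) by auto
    then obtain \<V> where "finite \<V>" "\<V> \<subseteq> range (\<lambda>i. U (s i))" "L \<subseteq> \<Union>\<V>"
      using L(1) unfolding compactin_def by meson
    then obtain I where I: "finite I" "L \<subseteq> (\<Union>i\<in>I. U (s i))"
      by (metis finite_subset_image)
    obtain m1 where m1: "\<And>i. i \<in> I \<Longrightarrow> i \<le> m1" using I(1) by (meson finite_nat_set_iff_bounded_le)
    obtain m2 where m2: "B \<le> real m2" using real_arch_simple by blast
    have "L \<subseteq> K (max m1 m2)"
    proof
      fix z assume z: "z \<in> L"
      then obtain i where i: "i \<in> I" "z \<in> U (s i)" using I by blast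
      have "z \<in> weak_star_cbox (canonical_embedding (s i)) (F (s i)) (e (s i) / 2)"
        using i(2) by (auto simp: U_def weak_star_box_def weak_star_cbox_def intro: less_imp_le)
      moreover have "i \<le> max m1 m2" using m1[OF i(1)] by simp
      moreover have "norm z \<le> real (max m1 m2)" using B[OF z] m2 by simp
      ultimately show "z \<in> K (max m1 m2)" by (auto simp: K_def)
    qed
    then show "\<exists>m. L \<subseteq> K m" ..
  next
    fix m z assume "z \<in> K m"
    then obtain i where "z \<in> weak_star_cbox (canonical_embedding (s i)) (F (s i)) (e (s i) / 2)"
      by (auto simp: K_def)
    then have "z \<in> weak_star_box (canonical_embedding (s i)) (F (s i)) (e (s i))"
      unfolding weak_star_box_def weak_star_cbox_def using e[of "s i"] by force
    then show "\<exists>x F e. finite F \<and> z \<in> weak_star_box (canonical_embedding x) F e \<and>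
        small_weak_star_box d k \<eta> x F e"
      using fin small by blast
  qed
qed

section \<open>Assembly over all radii and precisions\<close>

theorem theorem3p4:
  assumes "polish_banach TYPE('a::banach)"
  shows "strongly_K_sigma_delta_banach TYPE('a)"
proof -
  obtain M d where ms: "Metric_space M d" "Metric_space.mcomplete M d"
    and top: "subtopology weak_topology (cball (0::'a) 1) = Metric_space.mtopology M d"
    using assms unfolding polish_banach_def polish_space_def completely_metrizable_space_def by blast
  let ?R = "range (canonical_embedding :: 'a \<Rightarrow> _)"
  \<comment> \<open>The index \<open>n\<close> codes a pair (a, b) standing for precision 1/(a+1)
    and radius b+1; the successors keep both positive.\<close>
  define small where "small n z \<longleftrightarrow> (\<exists>x F e. finite F \<and> z \<in> weak_star_box (canonical_embedding x) F e \<and>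
      small_weak_star_box d (real (Suc (snd (prod_decode n)))) (inverse (real (Suc (fst (prod_decode n))))) x F e)"
    for n and z :: "('a \<Rightarrow>\<^sub>L real) \<Rightarrow>\<^sub>L real"
  have "\<exists>K. (\<forall>m. compactin weak_star_topology (K m)) \<and>
      (\<forall>L. compactin weak_star_topology L \<longrightarrow> L \<subseteq> ?R \<longrightarrow> (\<exists>m :: nat. L \<subseteq> K m)) \<and>
      (\<forall>m. \<forall>z \<in> K m. small n z)" for n
    using weak_star_compact_cover[OF assms ms(1) top, of "real (Suc (snd (prod_decode n)))"
        "inverse (real (Suc (fst (prod_decode n))))"]
    unfolding small_def by (metis inverse_positive_iff_positive of_nat_0_less_iff zero_less_Suc)
  then obtain K where K: "\<And>n m. compactin weak_star_topology (K n m)"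
    "\<And>n L. compactin weak_star_topology L \<Longrightarrow> L \<subseteq> ?R \<Longrightarrow> \<exists>m :: nat. L \<subseteq> K n m"
    "\<And>n m z. z \<in> K n m \<Longrightarrow> small n z"
    by metis
  have "?R = (\<Inter>n. \<Union>m. K n m)"
  proof (intro equalityI subsetI)
    fix z assume "z \<in> ?R"
    \<comment> \<open>Singletons are compact, so the absorption of compact sets already gives this
      inclusion.\<close>
    then have "\<exists>m. {z} \<subseteq> K n m" for n
      by (intro K(2)) (auto simp: strong_operator_topology_topspace)
    then show "z \<in> (\<Inter>n. \<Union>m. K n m)" by auto
  next
    fix z assume "z \<in> (\<Inter>n. \<Union>m. K n m)"
    then have sm: "small n z" for n using K(3) by blast
    \<comment> \<open>The radius is fixed once for \<open>z\<close>; then only the indices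
      \<open>prod_encode (a, b)\<close> with varying \<open>a\<close> enter.\<close>
    obtain b where b: "norm z \<le> real b" using real_arch_simple by blast
    show "z \<in> ?R"
    proof (rule in_range_canonical_embedding[OF ms top])
      show "norm z \<le> real (Suc b)" using b by simp
      show "\<exists>x F e. finite F \<and> z \<in> weak_star_box (canonical_embedding x) F e \<and>
          small_weak_star_box d (real (Suc b)) (inverse (real (Suc a))) x F e" for a
        using sm[of "prod_encode (a, b)"] by (simp add: small_def)
    qed simp
  qed
  with K show ?thesis
    unfolding strongly_K_sigma_delta_banach_def strongly_K_sigma_delta_in_def by blast
qed

end
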